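(* (i) Let $q$ be a prime power, $n$ a positive integer, and $1\le i\le n-1$. If $\gamma\in\mathbb{F}_q$, then the polynomial $f(x)=x+\gamma\,\mathrm{Tr}_q^{q^n}\left(x^2-x^{q^i+1}\right)$ permutes $\mathbb{F}_{q^n}$. (ii) Let $q$ be an odd prime power and let $\gamma\in\mathbb{F}_{q^2}$. The polynomial $f(x)=x+\gamma\,\mathrm{Tr}_q^{q^2}\left(x^2-x^{q+1}\right)$ over $\mathbb{F}_{q^2}$ is a permutation polynomial if and only if $\gamma\in\mathbb{F}_q$.
   Context: $\mathrm{Tr}_q^{q^n}:\mathbb{F}_{q^n}\to\mathbb{F}_q$ is the trace map $\mathrm{Tr}_q^{q^n}(x)=x+x^q+\cdots+x^{q^{n-1}}$. A polynomial $f$ over a finite field is a permutation polynomial (permutes the field) if the map $x\mapsto f(x)$ is a bijection of the field onto itself. *)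

theory Defs
  imports
    "HOL-Computational_Algebra.Computational_Algebra"
    "HOL-Number_Theory.Prime_Powers"
    "HOL-Library.Cardinality"
    "HOL-Algebra.Algebraic_Closure_Type"
begin

text \<open>
  The trace expression \<open>x + x^q + \<dots> + x^(q^(n-1))\<close>.  It is stated over an arbitrary commutative
  semiring, so that it applies both to elements of the field with \<open>q^n\<close> elements (where it is the
  trace map to the subfield with \<open>q\<close> elements) and to polynomials over that field (where it is the
  formal composition of the trace polynomial with a polynomial, see \<open>poly_Tr\<close>).
\<close>

definition Tr :: "nat \<Rightarrow> nat \<Rightarrow> 'a::comm_semiring_1 \<Rightarrow> 'a" where
  "Tr q n x = (\<Sum>j<n. x ^ (q ^ j))"

definition permutation_poly :: "'a::{field,finite} poly \<Rightarrow> bool" where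
  "permutation_poly f \<longleftrightarrow> bij (poly f)"

definition trace_perm :: "nat \<Rightarrow> nat \<Rightarrow> nat \<Rightarrow> 'a::field \<Rightarrow> 'a poly" where
  "trace_perm q n i \<gamma> =
     [:0, 1:] + smult \<gamma> (Tr q n ([:0, 1:] ^ 2 - [:0, 1:] ^ (q ^ i + 1)))"

lemma poly_Tr: "poly (Tr q n p) x = Tr q n (poly p x)"
  by (simp add: Tr_def poly_sum)

lemma poly_trace_perm:
  "poly (trace_perm q n i \<gamma>) x = x + \<gamma> * Tr q n (x ^ 2 - x ^ (q ^ i + 1))"
  by (simp add: trace_perm_def poly_Tr)

text \<open>
  The field with \<open>q\<close> elements inside a field type \<open>'a\<close> with \<open>q^n\<close> elements: a subfield, in the
  sense of the locale \<open>subfield\<close>, of \<open>'a\<close> regarded as a ring structure.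
\<close>

definition is_Fq :: "nat \<Rightarrow> 'a::{field,finite} set \<Rightarrow> bool" where
  "is_Fq q K \<longleftrightarrow> subfield K (ring_of_type_algebra :: 'a ring) \<and> card K = q"

end

theory Submission
  imports Defs "HOL-Number_Theory.Residues"
begin

text \<open>
  Let \<open>\<phi>(x) = x^q\<close>.  If \<open>\<gamma>\<close> is fixed by \<open>\<phi>\<close> and \<open>f(x) = f(y)\<close>, then \<open>a = x - y\<close> is fixed by
  \<open>\<phi>\<close>, because traces are.  For such an \<open>a\<close>, replacing \<open>y\<close> by \<open>y + a\<close> changes \<open>y^2 - y^(q^i+1)\<close> by
  \<open>a (y - y^(q^i))\<close>, which has trace zero; hence \<open>f(y + a) = f(y) + a\<close> and \<open>a = 0\<close>.

  For \<open>n = 2\<close> the trace in question is \<open>(x - \<phi>(x))^2\<close>.  If \<open>d = \<gamma> - \<phi>(\<gamma>)\<close> is nonzero and \<open>q\<close> is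
  odd, then \<open>x = -1/(2 d)\<close> satisfies \<open>x - \<phi>(x) = -1/d\<close>, so \<open>c = f(x)\<close> satisfies
  \<open>c - \<phi>(c) = -1/d + d/d^2 = 0\<close>.  Thus \<open>f(c) = c = f(x)\<close> although \<open>x \<noteq> c\<close>.
\<close>

text \<open>Multiplication by a nonzero \<open>a\<close> permutes \<open>K - {0}\<close>; comparing
  products over this set gives \<open>a ^ (card K - 1) = 1\<close>. Asking only for closure under
  products covers both a subfield and the whole field.\<close>

lemma power_card_eq_self:
  fixes K :: "'a::field set"
  assumes "finite K" "0 \<in> K" and mult: "\<And>x y. x \<in> K \<Longrightarrow> y \<in> K \<Longrightarrow> x * y \<in> K" and "a \<in> K"
  shows "a ^ card K = a"
proof (cases "a = 0")
  case True
  then show ?thesis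
    using assms by (auto simp: power_0_left)
next
  case False
  let ?U = "K - {0}"
  have inj: "inj_on ((*) a) ?U"
    using False by (auto intro: inj_onI)
  have "(*) a ` ?U \<subseteq> ?U"
    using False mult \<open>a \<in> K\<close> by auto
  then have "(*) a ` ?U = ?U"
    using inj \<open>finite K\<close> by (simp add: endo_inj_surj)
  then have "prod id ?U = (\<Prod>y\<in>?U. a * y)"
    using prod.reindex[OF inj, of id] by simp
  also have "\<dots> = a ^ card ?U * prod id ?U"
    by (simp add: prod.distrib)
  finally have "a ^ card ?U = 1"
    using \<open>finite K\<close> by simp
  moreover have "card K = Suc (card ?U)"
    using \<open>finite K\<close> \<open>0 \<in> K\<close> by (metis card_Suc_Diff1)
  ultimately show ?thesis
    by simp
qed

text \<open>These are the roots of \<open>X^q - X\<close>, which has degree \<open>q\<close> because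
  \<open>q > 1\<close>.\<close>

lemma card_power_eq_self_le:
  assumes "q > 1"
  shows "card {x :: 'a::field. x ^ q = x} \<le> q"
proof -
  let ?p = "monom 1 q + - monom 1 1 :: 'a poly"
  have deg: "degree ?p = q"
    using assms by (subst degree_add_eq_left) (auto simp: degree_monom_eq)
  then have "?p \<noteq> 0"
    using assms by (metis degree_0 not_one_less_zero)
  from card_poly_roots_bound[OF this] show ?thesis
    by (simp only: deg) (simp add: poly_monom)
qed

text \<open>Elements of \<open>K\<close> are fixed by the \<open>q\<close>-th power, and there are
  at most \<open>q = card K\<close> fixed points, so inclusion forces equality.\<close>

lemma is_Fq_eq_fixed_points:
  fixes K :: "'a::{field,finite} set"
  assumes "is_Fq q K" "q > 1"
  shows "K = {x. x ^ q = x}"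
proof (rule card_seteq)
  have "subring K (ring_of_type_algebra :: 'a ring)"
    using assms(1) by (auto simp: is_Fq_def dest: subfieldE(1))
  note sub = subringE[OF this]
  have "0 \<in> K" "\<And>x y. x \<in> K \<Longrightarrow> y \<in> K \<Longrightarrow> x * y \<in> K"
    using sub by (auto simp: ring_of_type_algebra_def)
  then show "K \<subseteq> {x. x ^ q = x}"
    using power_card_eq_self[of K] assms(1) by (auto simp: is_Fq_def)
  show "card {x :: 'a. x ^ q = x} \<le> card K"
    using card_power_eq_self_le[OF assms(2)] assms(1) by (simp add: is_Fq_def)
qed auto

text \<open>The characteristic divides the order \<open>q ^ n\<close>, so it is the prime underlying
  \<open>q\<close>. Hence the \<open>q\<close>-th power is an iterate of Frobenius and is
  additive.\<close>

lemma CHAR_power_of_card: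
  assumes "primepow q" "CARD('a::{field,finite}) = q ^ n"
  obtains k where "Factorial_Ring.prime CHAR('a)" "q = CHAR('a) ^ k"
proof -
  from assms(1) obtain p k where p: "Factorial_Ring.prime p" "q = p ^ k"
    by (auto simp: primepow_def)
  have char: "Factorial_Ring.prime CHAR('a)"
    using prime_CHAR_semidom[where ?'a = 'a] finite_imp_CHAR_pos[where ?'a = 'a] by simp
  have "CHAR('a) dvd p ^ (k * n)"
    using CHAR_dvd_CARD[where ?'a = 'a] assms(2) p by (simp add: power_mult)
  then have "CHAR('a) = p"
    using char p(1) by (metis prime_dvd_power primes_dvd_imp_eq)
  then show ?thesis
    using that char p by blast
qed

lemma Frobenius_add:
  fixes x y :: "'a::{field,finite}"
  assumes "primepow q" "CARD('a) = q ^ n"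
  shows "(x + y) ^ q ^ i = x ^ q ^ i + y ^ q ^ i"
proof -
  obtain k where "Factorial_Ring.prime CHAR('a)" "q = CHAR('a) ^ k"
    using assms by (rule CHAR_power_of_card)
  then show ?thesis
    by (intro freshmans_dream'[where n = "k * i"]) (auto simp: power_mult)
qed

lemma Frobenius_diff:
  fixes x y :: "'a::{field,finite}"
  assumes "primepow q" "CARD('a) = q ^ n"
  shows "(x - y) ^ q ^ i = x ^ q ^ i - y ^ q ^ i"
  using Frobenius_add[OF assms, of "x - y" y i] by (simp add: algebra_simps)

lemma Frobenius_sum:
  fixes g :: "'b \<Rightarrow> 'a::{field,finite}"
  assumes "primepow q" "CARD('a) = q ^ n"
  shows "sum g A ^ q = (\<Sum>j\<in>A. g j ^ q)"
proof -
  obtain k where "Factorial_Ring.prime CHAR('a)" "q = CHAR('a) ^ k"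
    using assms by (rule CHAR_power_of_card)
  then show ?thesis
    by (intro freshmans_dream_sum') auto
qed

lemma power_CARD_eq_self: "(x :: 'a::{field,finite}) ^ CARD('a) = x"
  by (rule power_card_eq_self) auto

lemma fixed_power_eq_self:
  fixes a :: "'a::monoid_mult"
  assumes "a ^ q = a"
  shows "a ^ q ^ j = a"
  using assms by (induction j) (simp_all add: power_mult)

lemma Tr_add:
  fixes x y :: "'a::{field,finite}"
  assumes "primepow q" "CARD('a) = q ^ n"
  shows "Tr q m (x + y) = Tr q m x + Tr q m y"
  by (simp add: Tr_def Frobenius_add[OF assms] sum.distrib)

lemma Tr_diff:
  fixes x y :: "'a::{field,finite}"
  assumes "primepow q" "CARD('a) = q ^ n"
  shows "Tr q m (x - y) = Tr q m x - Tr q m y"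
  by (simp add: Tr_def Frobenius_diff[OF assms] sum_subtractf)

lemma Tr_mult_fixed:
  fixes a x :: "'a::comm_semiring_1"
  assumes "a ^ q = a"
  shows "Tr q n (a * x) = a * Tr q n x"
  by (simp add: Tr_def power_mult_distrib fixed_power_eq_self[OF assms] sum_distrib_left)

text \<open>The \<open>q\<close>-th power shifts the summands cyclically, since
  \<open>x ^ (q ^ n) = x\<close>.\<close>

lemma Tr_power_q:
  fixes x :: "'a::{field,finite}"
  assumes "CARD('a) = q ^ n"
  shows "Tr q n (x ^ q) = Tr q n x"
proof -
  have "x + (\<Sum>j<n. x ^ q ^ Suc j) = (\<Sum>j<Suc n. x ^ q ^ j)"
    by (subst sum.lessThan_Suc_shift) simp
  also have "\<dots> = (\<Sum>j<n. x ^ q ^ j) + x"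
    using power_CARD_eq_self[of x] assms by simp
  finally show ?thesis
    by (simp add: Tr_def power_mult)
qed

lemma Tr_power_q_power:
  fixes x :: "'a::{field,finite}"
  assumes "CARD('a) = q ^ n"
  shows "Tr q n (x ^ q ^ i) = Tr q n x"
proof (induction i)
  case (Suc i)
  have "x ^ q ^ Suc i = (x ^ q ^ i) ^ q"
    by (simp add: power_mult mult.commute flip: power_mult)
  then show ?case
    using Suc Tr_power_q[OF assms] by simp
qed simp

lemma Tr_fixed:
  fixes x :: "'a::{field,finite}"
  assumes "primepow q" "CARD('a) = q ^ n"
  shows "Tr q n x ^ q = Tr q n x"
proof -
  have "Tr q n x ^ q = Tr q n (x ^ q)"
    by (simp add: Tr_def Frobenius_sum[OF assms] mult.commute flip: power_mult)
  then show ?thesis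
    using Tr_power_q[OF assms(2)] by simp
qed

lemma trace_perm_translate:
  fixes x a :: "'a::{field,finite}"
  assumes "primepow q" "CARD('a) = q ^ n" "a ^ q = a"
  shows "poly (trace_perm q n i \<gamma>) (x + a) = poly (trace_perm q n i \<gamma>) x + a"
proof -
  have "(x + a) ^ q ^ i = x ^ q ^ i + a"
    by (simp add: Frobenius_add[OF assms(1,2)] fixed_power_eq_self[OF assms(3)])
  \<comment> \<open>The \<open>a^2\<close> terms cancel, and \<open>2 a x - a x - a x^(q^i)\<close>
    remains.\<close>
  then have "(x + a) ^ 2 - (x + a) ^ (q ^ i + 1) =
      (x ^ 2 - x ^ (q ^ i + 1)) + a * (x - x ^ q ^ i)"
    by (simp add: power2_eq_square algebra_simps)
  then have "Tr q n ((x + a) ^ 2 - (x + a) ^ (q ^ i + 1)) = Tr q n (x ^ 2 - x ^ (q ^ i + 1))"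
    by (simp only: Tr_add[OF assms(1,2)] Tr_diff[OF assms(1,2)] Tr_mult_fixed[OF assms(3)]
        Tr_power_q_power[OF assms(2)]) simp
  then show ?thesis
    by (simp only: poly_trace_perm) simp
qed

lemma permutation_poly_trace_perm:
  fixes \<gamma> :: "'a::{field,finite}"
  assumes "primepow q" "CARD('a) = q ^ n" "\<gamma> ^ q = \<gamma>"
  shows "permutation_poly (trace_perm q n i \<gamma>)"
proof -
  let ?f = "poly (trace_perm q n i \<gamma>)"
  have "inj ?f"
  proof (rule injI)
    fix x y assume eq: "?f x = ?f y"
    define a where "a = x - y"
    \<comment> \<open>Every factor on the right is fixed by the \<open>q\<close>-th power, hence so
      is \<open>a\<close>.\<close>
    have "a = \<gamma> * (Tr q n (y ^ 2 - y ^ (q ^ i + 1)) - Tr q n (x ^ 2 - x ^ (q ^ i + 1)))"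
      using eq unfolding poly_trace_perm a_def right_diff_distrib
      by (simp only: diff_eq_eq add.commute diff_add_eq eq_diff_eq)
    then have "a ^ q = a"
      using Frobenius_diff[OF assms(1,2), where i = 1]
      by (simp add: power_mult_distrib assms(3) Tr_fixed[OF assms(1,2)])
    from trace_perm_translate[OF assms(1,2) this, of i \<gamma> y] eq show "x = y"
      by (simp add: a_def)
  qed
  then show ?thesis
    by (simp add: permutation_poly_def bij_def finite_UNIV_inj_surj)
qed

text \<open>The \<open>q\<close>-th power is an involution here, so \<open>x^2 - x x^q\<close> and
  its conjugate \<open>(x^q)^2 - x x^q\<close> add up to a perfect square.\<close>

lemma poly_trace_perm_quadratic:
  fixes x \<gamma> :: "'a::{field,finite}"
  assumes "primepow q" "CARD('a) = q ^ 2"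
  shows "poly (trace_perm q 2 1 \<gamma>) x = x + \<gamma> * (x - x ^ q) ^ 2"
proof -
  have "(x ^ q) ^ q = x"
    using power_CARD_eq_self[of x] assms(2) by (simp add: power2_eq_square power_mult)
  moreover have "(x ^ 2 - x ^ (q + 1)) ^ q = (x ^ q) ^ 2 - (x ^ q) * (x ^ q) ^ q"
    using Frobenius_diff[OF assms, of "x ^ 2" "x ^ (q + 1)" 1]
    by (simp add: power_mult_distrib power2_eq_square)
  ultimately have "Tr q 2 (x ^ 2 - x ^ (q + 1)) = (x - x ^ q) ^ 2"
    by (simp add: Tr_def numeral_2_eq_2) (simp add: power2_eq_square algebra_simps)
  then show ?thesis
    by (simp only: poly_trace_perm power_one_right)
qed

lemma not_permutation_poly_trace_perm_quadratic:
  fixes \<gamma> :: "'a::{field,finite}"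
  assumes "primepow q" "odd q" "CARD('a) = q ^ 2" "\<gamma> ^ q \<noteq> \<gamma>"
  shows "\<not> permutation_poly (trace_perm q 2 1 \<gamma>)"
proof
  let ?f = "poly (trace_perm q 2 1 \<gamma>)"
  note frob = Frobenius_add[OF assms(1,3), where i = 1, simplified]
    Frobenius_diff[OF assms(1,3), where i = 1, simplified]
  assume "permutation_poly (trace_perm q 2 1 \<gamma>)"
  then have inj: "inj ?f"
    by (simp add: permutation_poly_def bij_is_inj)
  define d where "d = \<gamma> - \<gamma> ^ q"
  have "(\<gamma> ^ q) ^ q = \<gamma>"
    using power_CARD_eq_self[of \<gamma>] assms(3) by (simp add: power2_eq_square power_mult)
  then have dq: "d ^ q = - d"
    by (simp add: d_def frob)
  have "d \<noteq> 0"
    using assms(4) by (auto simp: d_def)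
  obtain k where k: "Factorial_Ring.prime CHAR('a)" "q = CHAR('a) ^ k"
    using assms(1,3) by (rule CHAR_power_of_card)
  \<comment> \<open>With a positive exponent, characteristic 2 would make \<open>q\<close> even; so
    2 is invertible.\<close>
  then have "k \<noteq> 0"
    using primepow_gt_Suc_0[OF assms(1)] k(2) by (intro notI) simp
  then have "CHAR('a) \<noteq> 2"
    using assms(2) k(2) by auto
  then have "(2 :: 'a) \<noteq> 0"
    using k(1) of_nat_eq_0_iff_char_dvd[where ?'a = 'a and n = 2] two_is_prime_nat
    by (auto simp: primes_dvd_imp_eq)
  have "(2 :: 'a) ^ q = 2"
    using frob(1)[of 1 1] by simp
  \<comment> \<open>If \<open>t = x - x^q\<close>, the image \<open>c\<close> of \<open>x\<close>
    satisfies \<open>c - c^q = t + d t^2\<close>, with nonzero root \<open>t = -1/d\<close>. An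
    \<open>x\<close> with \<open>x^q = -x\<close> has \<open>t = 2 x\<close>, which dictates this
    choice.\<close>
  define x where "x = - 1 / (2 * d)"
  have "x ^ q = - x"
    using assms(2) by (simp add: x_def power_divide power_mult_distrib dq \<open>2 ^ q = 2\<close>)
  then have diff: "x - x ^ q = - 1 / d"
    using \<open>2 \<noteq> 0\<close> \<open>d \<noteq> 0\<close> by (simp add: x_def field_simps)
  define c where "c = ?f x"
  have c: "c = x + \<gamma> * (1 / d ^ 2)"
    by (simp only: c_def poly_trace_perm_quadratic[OF assms(1,3)] diff) (simp add: power_divide)
  have "(d ^ 2) ^ q = d ^ 2"
    by (metis dq power_mult mult.commute power2_minus)
  then have "c ^ q = x ^ q + \<gamma> ^ q * (1 / d ^ 2)"
    by (simp add: c frob power_mult_distrib power_divide)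
  then have "c - c ^ q = (x - x ^ q) + (\<gamma> - \<gamma> ^ q) * (1 / d ^ 2)"
    by (simp add: c algebra_simps diff_divide_distrib)
  also have "\<dots> = 0"
    using \<open>d \<noteq> 0\<close> by (simp only: diff flip: d_def) (simp add: power2_eq_square)
  finally have "c ^ q = c"
    by simp
  \<comment> \<open>The quadratic term vanishes at fixed points of the \<open>q\<close>-th
    power.\<close>
  then have "?f c = c"
    by (simp only: poly_trace_perm_quadratic[OF assms(1,3)]) simp
  then have "c = x"
    unfolding c_def by (rule injD[OF inj])
  \<comment> \<open>\<open>c = x\<close> would give \<open>x - x^q = 0\<close>, against the value
    \<open>-1/d\<close>.\<close>
  then show False
    using diff \<open>c ^ q = c\<close> \<open>d \<noteq> 0\<close> by simp
qed

theorem theorem3p5: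
  shows
    "(\<forall>q n i (K :: 'a::{field,finite} set) \<gamma>.
        primepow q \<longrightarrow> n \<ge> 1 \<longrightarrow> 1 \<le> i \<longrightarrow> i \<le> n - 1 \<longrightarrow>
        CARD('a) = q ^ n \<longrightarrow> is_Fq q K \<longrightarrow> \<gamma> \<in> K \<longrightarrow>
        permutation_poly (trace_perm q n i \<gamma>)) \<and>
     (\<forall>q (K :: 'a set) (\<gamma> :: 'a).
        primepow q \<longrightarrow> odd q \<longrightarrow> CARD('a) = q ^ 2 \<longrightarrow> is_Fq q K \<longrightarrow>
        (permutation_poly (trace_perm q 2 1 \<gamma>) \<longleftrightarrow> \<gamma> \<in> K))"
proof -
  \<comment> \<open>This turns membership in \<open>K\<close> into the equation used in both
    parts.\<close>
  have "\<gamma> \<in> K \<longleftrightarrow> \<gamma> ^ q = \<gamma>" if "primepow q" "is_Fq q K" for q and K :: "'a set" and \<gamma>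
    using is_Fq_eq_fixed_points[OF that(2)] primepow_gt_Suc_0[OF that(1)] by auto
  then show ?thesis
    using permutation_poly_trace_perm not_permutation_poly_trace_perm_quadratic by blast
qed

end
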